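(* For all positive integers $s,t$ with $st>2(s+t)$, there exists a constant $\gamma=\gamma(s,t)>0$ such that for every sufficiently large integer $n$ there exists an edge-coloring of the complete graph $K_n$ that contains no properly colored $K_{s,t}$ and has minimum color degree $\delta^c>n/2+\gamma\, n^{1-\frac{s+t}{st-s-t}}$.
   Context: An edge-colored graph is a graph with a color assigned to each edge (not necessarily proper). The color degree of a vertex is the number of distinct colors on edges incident to it; $\delta^c$ is the minimum color degree. A subgraph is properly colored if any two adjacent edges of it receive different colors. *)

theory Defs
  imports Complex_Main
begin

text \<open>
  A finite simple graph is given by a vertex set \<open>V\<close> together with a set \<open>E\<close> of edges, each edge
  being a two-element subset of \<open>V\<close>.  An edge-coloring is an arbitrary function \<open>c\<close> on sets of
  vertices, of which only the values on \<open>E\<close> matter.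
\<close>

definition complete_graph_edges :: "'v set \<Rightarrow> 'v set set" where
  "complete_graph_edges V = {e. e \<subseteq> V \<and> card e = 2}"

definition complete_bipartite_edges :: "'v set \<Rightarrow> 'v set \<Rightarrow> 'v set set" where
  "complete_bipartite_edges A B = {{a, b} | a b. a \<in> A \<and> b \<in> B}"

definition color_degree :: "'v set set \<Rightarrow> ('v set \<Rightarrow> 'c) \<Rightarrow> 'v \<Rightarrow> nat" where
  "color_degree E c v = card (c ` {e \<in> E. v \<in> e})"

text \<open>Meaningful for finite nonempty \<open>V\<close> only.\<close>

definition min_color_degree :: "'v set \<Rightarrow> 'v set set \<Rightarrow> ('v set \<Rightarrow> 'c) \<Rightarrow> nat" where
  "min_color_degree V E c = Min (color_degree E c ` V)"

definition properly_colored :: "'v set set \<Rightarrow> ('v set \<Rightarrow> 'c) \<Rightarrow> bool" where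
  "properly_colored F c \<longleftrightarrow> (\<forall>e\<in>F. \<forall>f\<in>F. e \<noteq> f \<and> e \<inter> f \<noteq> {} \<longrightarrow> c e \<noteq> c f)"

text \<open>
  The copy of \<open>K\<^sub>s\<^sub>,\<^sub>t\<close> is a subgraph that need not be induced.  For positive \<open>s\<close> and \<open>t\<close>, the
  cardinality conditions force \<open>A\<close> and \<open>B\<close> to be finite.
\<close>

definition contains_properly_colored_biclique ::
  "nat \<Rightarrow> nat \<Rightarrow> 'v set \<Rightarrow> 'v set set \<Rightarrow> ('v set \<Rightarrow> 'c) \<Rightarrow> bool" where
  "contains_properly_colored_biclique s t V E c \<longleftrightarrow>
     (\<exists>A B. A \<subseteq> V \<and> B \<subseteq> V \<and> A \<inter> B = {} \<and> card A = s \<and> card B = t \<and>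
        complete_bipartite_edges A B \<subseteq> E \<and>
        properly_colored (complete_bipartite_edges A B) c)"

end

theory Submission
  imports Defs "HOL-Library.FuncSet" "HOL-Library.Nat_Bijection" "HOL-Real_Asymp.Real_Asymp"
begin

text \<open>
  Orient \<open>K\<^sub>n\<close> as a nearly regular circulant tournament and give each edge its head as color.  Every
  color degree is then about \<open>n/2\<close>.  In a properly colored subgraph each vertex is the head of at
  most one edge, so a copy of \<open>K\<^sub>s\<^sub>,\<^sub>t\<close> would have at most \<open>s + t\<close> edges.  Now give pairwise distinct
  new colors to the edges of a sparse graph \<open>G\<close>: a properly colored \<open>K\<^sub>s\<^sub>,\<^sub>t\<close> must have at least
  \<open>e = st - s - t\<close> edges in \<open>G\<close>, while each vertex gains its in-degree in \<open>G\<close>.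

  To build \<open>G\<close>, split the in-neighborhood of each vertex into \<open>d\<close> blocks of size \<open>k\<close> and choose one
  in-edge from each block.  A fixed set of \<open>e\<close> arcs is contained in at most a fraction \<open>k\<^sup>-\<^sup>e\<close> of these
  choices, and at most \<open>n\<^sup>s\<^sup>+\<^sup>t 2\<^sup>s\<^sup>t\<close> sets of arcs have to be avoided, so \<open>k\<close> of order \<open>n\<^sup>(\<^sup>s\<^sup>+\<^sup>t\<^sup>)\<^sup>/\<^sup>e\<close>
  suffices.
\<close>

section \<open>Counting functions whose graph contains prescribed pairs\<close>

text \<open>If some graph contains \<open>P\<close>, then \<open>P\<close> has pairwise distinct
  first coordinates. It therefore fixes the value at exactly \<open>card P\<close> arguments and
  leaves the others free. If no graph contains \<open>P\<close>, the left side is 0.\<close>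

lemma card_PiE_containing:
  assumes "finite I" "finite K" "K \<noteq> {}" "finite P"
  shows "card {w \<in> I \<rightarrow>\<^sub>E K. P \<subseteq> (\<lambda>i. (i, w i)) ` I} * card K ^ card P \<le> card (I \<rightarrow>\<^sub>E K)"
    (is "card ?S * _ \<le> _")
proof (cases "?S = {}")
  case False
  then obtain w0 where w0: "w0 \<in> I \<rightarrow>\<^sub>E K" "P \<subseteq> (\<lambda>i. (i, w0 i)) ` I"
    by blast
  define J where "J = fst ` P"
  have J: "J \<subseteq> I" "finite J"
    using w0(2) \<open>finite P\<close> by (auto simp: J_def)
  have "inj_on fst P"
    by (rule inj_on_subset[OF _ w0(2)]) (auto simp: inj_on_def)
  then have cardJ: "card J = card P"
    by (simp add: J_def card_image)
  have "?S \<subseteq> (\<Pi>\<^sub>E i\<in>I. if i \<in> J then {w0 i} else K)"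
  proof
    fix w assume w: "w \<in> ?S"
    have "w i = w0 i" if "i \<in> J" for i
    proof -
      from that obtain j where "(i, j) \<in> P"
        by (auto simp: J_def)
      then show ?thesis
        using w w0(2) by blast
    qed
    then show "w \<in> (\<Pi>\<^sub>E i\<in>I. if i \<in> J then {w0 i} else K)"
      using w by (auto simp: PiE_iff)
  qed
  moreover have "finite (\<Pi>\<^sub>E i\<in>I. if i \<in> J then {w0 i} else K)"
    using assms by (intro finite_PiE) auto
  ultimately have "card ?S \<le> card (\<Pi>\<^sub>E i\<in>I. if i \<in> J then {w0 i} else K)"
    by (intro card_mono)
  also have "\<dots> = (\<Prod>i\<in>I. if i \<in> J then 1 else card K)"
    using assms by (simp add: card_PiE if_distrib cong: if_cong)
  also have "\<dots> = card K ^ card (I - J)"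
    using assms J by (simp add: prod.If_cases Diff_eq)
  finally have "card ?S * card K ^ card P \<le> card K ^ card (I - J) * card K ^ card J"
    by (simp add: cardJ)
  also have "\<dots> = card K ^ card I"
    using J assms(1) by (simp add: power_add[symmetric] card_Diff_subset card_mono)
  also have "\<dots> = card (I \<rightarrow>\<^sub>E K)"
    using assms by (simp add: card_PiE)
  finally show ?thesis .
next
  case True
  then show ?thesis
    by (simp only: card.empty)
qed

text \<open>Union bound: each \<open>P\<close> rules out at most a fraction 1 /
  \<open>card K ^ e\<close> of the nonempty function space, and there are fewer than
  \<open>card K ^ e\<close> sets \<open>P\<close>.\<close>

lemma exists_assignment_avoiding:
  assumes "finite I" "finite K" "K \<noteq> {}" "finite \<F>"
    and P: "\<And>P. P \<in> \<F> \<Longrightarrow> finite P \<and> card P = e"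
    and less: "card \<F> < card K ^ e"
  obtains w where "w \<in> I \<rightarrow>\<^sub>E K" "\<And>P. P \<in> \<F> \<Longrightarrow> \<not> P \<subseteq> (\<lambda>i. (i, w i)) ` I"
proof -
  let ?B = "\<lambda>P. {w \<in> I \<rightarrow>\<^sub>E K. P \<subseteq> (\<lambda>i. (i, w i)) ` I}"
  have fin: "finite (I \<rightarrow>\<^sub>E K)"
    using assms by (intro finite_PiE) auto
  have ne: "I \<rightarrow>\<^sub>E K \<noteq> {}"
    using assms by (simp add: PiE_eq_empty_iff)
  have "card (\<Union>P\<in>\<F>. ?B P) * card K ^ e \<le> (\<Sum>P\<in>\<F>. card (?B P)) * card K ^ e"
    using \<open>finite \<F>\<close> by (intro mult_right_mono card_UN_le) auto
  also have "\<dots> = (\<Sum>P\<in>\<F>. card (?B P) * card K ^ e)"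
    by (simp add: sum_distrib_right)
  also have "\<dots> \<le> (\<Sum>P\<in>\<F>. card (I \<rightarrow>\<^sub>E K))"
  proof (rule sum_mono)
    fix P assume "P \<in> \<F>"
    then show "card (?B P) * card K ^ e \<le> card (I \<rightarrow>\<^sub>E K)"
      using card_PiE_containing[OF assms(1-3), of P] P[of P] by simp
  qed
  also have "\<dots> = card \<F> * card (I \<rightarrow>\<^sub>E K)"
    by simp
  also have "\<dots> < card K ^ e * card (I \<rightarrow>\<^sub>E K)"
    using less ne fin by (simp add: card_gt_0_iff)
  finally have "card (\<Union>P\<in>\<F>. ?B P) < card (I \<rightarrow>\<^sub>E K)"
    by (simp add: mult.commute)
  then have "\<not> (I \<rightarrow>\<^sub>E K) \<subseteq> (\<Union>P\<in>\<F>. ?B P)"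
    using card_mono[of "\<Union>P\<in>\<F>. ?B P" "I \<rightarrow>\<^sub>E K"] fin \<open>finite \<F>\<close> by fastforce
  then show ?thesis
    using that by blast
qed

section \<open>Biclique edges, arcs of the circulant tournament and the coloring\<close>

lemma complete_bipartite_edges_eq_image:
  "complete_bipartite_edges A B = (\<lambda>(a, b). {a, b}) ` (A \<times> B)"
  by (auto simp: complete_bipartite_edges_def)

lemma finite_complete_bipartite_edges:
  "finite A \<Longrightarrow> finite B \<Longrightarrow> finite (complete_bipartite_edges A B)"
  by (simp add: complete_bipartite_edges_eq_image)

lemma card_complete_bipartite_edges:
  assumes "A \<inter> B = {}"
  shows "card (complete_bipartite_edges A B) = card A * card B"
proof -
  have "inj_on (\<lambda>(a, b). {a, b}) (A \<times> B)"
    using assms by (auto simp: inj_on_def doubleton_eq_iff)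
  then show ?thesis
    by (simp add: complete_bipartite_edges_eq_image card_image card_cartesian_product)
qed

text \<open>The arc with head \<open>v\<close> given by the \<open>j\<close>-th element of the \<open>i\<close>-th block of in-neighbors of \<open>v\<close>.\<close>

definition arc :: "nat \<Rightarrow> nat \<Rightarrow> (nat \<times> nat) \<times> nat \<Rightarrow> nat set" where
  "arc n k = (\<lambda>((v, i), j). {v, (v + Suc (i * k + j)) mod n})"

text \<open>
  The arcs of the tournament lead from \<open>v + a\<close> (mod \<open>n\<close>) to \<open>v\<close> for \<open>1 \<le> a \<le> (n - 1) div 2\<close>; for even
  \<open>n\<close> an antipodal pair has the larger vertex as head.
\<close>

definition head :: "nat \<Rightarrow> nat set \<Rightarrow> nat" where
  "head n e = (if Max e - Min e \<le> (n - 1) div 2 then Min e else Max e)"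

text \<open>
  Adding \<open>n\<close> separates the colors on \<open>G\<close> from the heads, and \<^const>\<open>set_encode\<close> is injective
  on finite sets only.
\<close>

definition head_coloring :: "nat \<Rightarrow> nat set set \<Rightarrow> nat set \<Rightarrow> nat" where
  "head_coloring n G e = (if e \<in> G then n + set_encode e else head n e)"

lemma mod_add_if:
  fixes v a n :: nat
  assumes "v < n" "a \<le> n"
  shows "(v + a) mod n = (if v + a < n then v + a else v + a - n)"
  using assms by (simp add: mod_if)

lemma block_index_less:
  fixes i j d k :: nat
  assumes "i < d" "j < k"
  shows "i * k + j < d * k"
proof -
  have "i * k + j < Suc i * k"
    using assms by simp
  also have "\<dots> \<le> d * k"
    using assms by (intro mult_right_mono) auto
  finally show ?thesis .
qed

lemma block_index_inj:
  fixes i i' j j' k :: nat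
  assumes "i * k + j = i' * k + j'" "j < k" "j' < k"
  shows "i = i'" "j = j'"
proof -
  have "(i * k + j) div k = (i' * k + j') div k"
    using assms(1) by simp
  then show "i = i'"
    using assms(2,3) by simp
  then show "j = j'"
    using assms(1) by simp
qed

text \<open>All offsets lie strictly between 0 and n/2. If two arcs gave the same edge with the
  endpoints swapped, their offsets would add up to a multiple of \<open>n\<close>, which is
  impossible. So head and offset are determined by the edge, and the offset determines block and
  position.\<close>

lemma inj_on_arc:
  assumes "d * k \<le> (n - 1) div 2"
  shows "inj_on (arc n k) (({..<n} \<times> {..<d}) \<times> {..<k})"
proof (rule inj_onI, clarify)
  fix v i j v' i' j'
  assume *: "arc n k ((v, i), j) = arc n k ((v', i'), j')"
    and v: "v < n" "v' < n" and i: "i < d" "i' < d" and j: "j < k" "j' < k"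
  define a a' where "a = Suc (i * k + j)" and "a' = Suc (i' * k + j')"
  have a: "a \<le> (n - 1) div 2" "a' \<le> (n - 1) div 2" "0 < a" "0 < a'"
    using block_index_less[of i d j k] block_index_less[of i' d j' k] i j assms
    by (auto simp: a_def a'_def)
  then have "2 * a < n" "2 * a' < n"
    using v by auto
  moreover from this have "{v, if v + a < n then v + a else v + a - n}
      = {v', if v' + a' < n then v' + a' else v' + a' - n}"
    using * v mod_add_if[of v n a] mod_add_if[of v' n a'] by (simp add: arc_def a_def a'_def)
  ultimately have "v = v' \<and> a = a'"
    using a(3,4) v by (auto simp: doubleton_eq_iff split: if_splits)
  then show "((v, i) = (v', i')) \<and> j = j'"
    using block_index_inj[of i k j i' j'] j by (auto simp: a_def a'_def)
qed

section \<open>Selecting one in-arc per block so that no biclique receives many\<close>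

lemma card_biclique_pairs_le:
  assumes "0 < s" "0 < t"
  shows "finite {(A, B). A \<subseteq> {..<n::nat} \<and> B \<subseteq> {..<n} \<and> A \<inter> B = {} \<and> card A = s \<and> card B = t}"
      (is "finite ?S")
    and "card {(A, B). A \<subseteq> {..<n::nat} \<and> B \<subseteq> {..<n} \<and> A \<inter> B = {} \<and> card A = s \<and> card B = t}
      \<le> n ^ (s + t)"
proof -
  let ?T = "{A. A \<subseteq> {..<n} \<and> card A = s} \<times> {B. B \<subseteq> {..<n} \<and> card B = t}"
  have sub: "?S \<subseteq> ?T"
    by auto
  have fin: "finite ?T"
    by simp
  show "finite ?S"
    using sub fin by (rule finite_subset)
  have choose: "n choose r \<le> n ^ r" if "0 < r" for r
    using that by (cases "r \<le> n") (auto simp: binomial_le_pow binomial_eq_0)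
  have "card ?S \<le> card ?T"
    using sub fin by (intro card_mono)
  also have "\<dots> = (n choose s) * (n choose t)"
    by (simp add: card_cartesian_product n_subsets)
  also have "\<dots> \<le> n ^ s * n ^ t"
    using choose assms by (intro mult_mono) auto
  finally show "card ?S \<le> n ^ (s + t)"
    by (simp add: power_add)
qed

lemma exists_sparse_selection:
  assumes "0 < s" "0 < t" "0 < k" and dk: "d * k \<le> (n - 1) div 2"
    and less: "n ^ (s + t) * 2 ^ (s * t) < k ^ e"
  obtains w where "w \<in> {..<n} \<times> {..<d} \<rightarrow> {..<k}"
    "\<And>A B. A \<subseteq> {..<n} \<Longrightarrow> B \<subseteq> {..<n} \<Longrightarrow> A \<inter> B = {} \<Longrightarrow> card A = s \<Longrightarrow> card B = t \<Longrightarrow>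
       card (complete_bipartite_edges A B \<inter> (\<lambda>x. arc n k (x, w x)) ` ({..<n} \<times> {..<d})) < e"
proof -
  define I where "I = {..<n} \<times> {..<d}"
  define pairs where
    "pairs = {(A, B). A \<subseteq> {..<n} \<and> B \<subseteq> {..<n} \<and> A \<inter> B = {} \<and> card A = s \<and> card B = t}"
  define arcs where
    "arcs = (\<lambda>(A, B). {p \<in> I \<times> {..<k}. arc n k p \<in> complete_bipartite_edges A B})"
  \<comment> \<open>The forbidden patterns: \<open>e\<close> index pairs whose arcs all fall into
    one biclique. As \<open>arc\<close> is injective here, a biclique contains at most
    \<open>s * t\<close> arcs and contributes at most \<open>2 ^ (s * t)\<close> patterns.\<close>
  define \<F> where "\<F> = (\<Union>p\<in>pairs. {P \<in> Pow (arcs p). card P = e})"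
  have inj: "inj_on (arc n k) (I \<times> {..<k})"
    using inj_on_arc[OF dk] by (simp add: I_def)
  have finI: "finite I"
    by (simp add: I_def)
  have ne: "{..<k} \<noteq> {}"
    using \<open>0 < k\<close> by auto
  have fin_arcs: "finite (arcs p)" for p
    using finI by (auto simp: arcs_def split: prod.split)
  have fin_pairs: "finite pairs" and card_pairs: "card pairs \<le> n ^ (s + t)"
    using card_biclique_pairs_le[OF assms(1,2)] by (simp_all add: pairs_def)
  have card_arcs: "card (arcs p) \<le> s * t" if "p \<in> pairs" for p
  proof -
    obtain A B where p: "p = (A, B)" "A \<inter> B = {}" "card A = s" "card B = t"
      using \<open>p \<in> pairs\<close> by (auto simp: pairs_def)
    then have fin: "finite A" "finite B"
      using assms(1,2) card_ge_0_finite by blast+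
    have "card (arcs p) = card (arc n k ` arcs p)"
      using inj by (intro card_image[symmetric]) (auto simp: arcs_def p inj_on_def)
    also have "\<dots> \<le> card (complete_bipartite_edges A B)"
      using p fin by (intro card_mono finite_complete_bipartite_edges) (auto simp: arcs_def)
    finally show ?thesis
      using p by (simp add: card_complete_bipartite_edges)
  qed
  have "card \<F> \<le> (\<Sum>p\<in>pairs. card {P \<in> Pow (arcs p). card P = e})"
    unfolding \<F>_def using fin_pairs by (rule card_UN_le)
  also have "\<dots> \<le> (\<Sum>p\<in>pairs. 2 ^ (s * t))"
  proof (rule sum_mono)
    fix p assume p: "p \<in> pairs"
    have "card {P \<in> Pow (arcs p). card P = e} \<le> card (Pow (arcs p))"
      using fin_arcs by (intro card_mono) auto
    also have "\<dots> \<le> 2 ^ (s * t)"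
      using fin_arcs card_arcs[OF p] by (simp add: card_Pow)
    finally show "card {P \<in> Pow (arcs p). card P = e} \<le> 2 ^ (s * t)" .
  qed
  also have "\<dots> \<le> n ^ (s + t) * 2 ^ (s * t)"
    using card_pairs by simp
  finally have "card \<F> < card {..<k} ^ e"
    using less by simp
  moreover have "finite \<F>"
    unfolding \<F>_def using fin_pairs fin_arcs by auto
  moreover have "finite P \<and> card P = e" if "P \<in> \<F>" for P
    using that fin_arcs by (auto simp: \<F>_def dest: finite_subset)
  ultimately obtain w where w: "w \<in> I \<rightarrow>\<^sub>E {..<k}"
      and avoid: "\<And>P. P \<in> \<F> \<Longrightarrow> \<not> P \<subseteq> (\<lambda>x. (x, w x)) ` I"
    using exists_assignment_avoiding[OF finI finite_lessThan ne, of \<F> e] by blast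
  show thesis
  proof (rule that)
    show "w \<in> {..<n} \<times> {..<d} \<rightarrow> {..<k}"
      using w by (auto simp: I_def)
  next
    fix A B
    assume AB: "A \<subseteq> {..<n}" "B \<subseteq> {..<n}" "A \<inter> B = {}" "card A = s" "card B = t"
    let ?Q = "{p \<in> (\<lambda>x. (x, w x)) ` I. arc n k p \<in> complete_bipartite_edges A B}"
    have Q: "?Q \<subseteq> arcs (A, B)"
      using w by (auto simp: arcs_def)
    \<comment> \<open>Any \<open>e\<close> elements of \<open>?Q\<close> would form a forbidden
      pattern inside the graph of \<open>w\<close>.\<close>
    have "card ?Q < e"
    proof (rule ccontr)
      assume "\<not> card ?Q < e"
      then obtain P where "P \<subseteq> ?Q" "card P = e"
        by (meson obtain_subset_with_card_n not_less)
      moreover from this have "P \<in> \<F>"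
      proof -
        have "(A, B) \<in> pairs"
          using AB by (simp add: pairs_def)
        moreover have "P \<subseteq> arcs (A, B)"
          using \<open>P \<subseteq> ?Q\<close> Q by (rule subset_trans)
        ultimately show ?thesis
          unfolding \<F>_def using \<open>card P = e\<close> by blast
      qed
      ultimately show False
        using avoid by blast
    qed
    moreover have "complete_bipartite_edges A B \<inter> (\<lambda>x. arc n k (x, w x)) ` I = arc n k ` ?Q"
      by auto
    moreover have "card (arc n k ` ?Q) \<le> card ?Q"
      using finI by (intro card_image_le) auto
    ultimately show "card (complete_bipartite_edges A B \<inter>
        (\<lambda>x. arc n k (x, w x)) ` ({..<n} \<times> {..<d})) < e"
      by (simp add: I_def)
  qed
qed

section \<open>Properly colored bicliques and color degrees under the head coloring\<close>

lemma head_mem: "finite e \<Longrightarrow> e \<noteq> {} \<Longrightarrow> head n e \<in> e"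
  by (simp add: head_def)

text \<open>Each vertex is the head of at most one edge outside \<open>G\<close>.\<close>

lemma card_properly_colored_biclique_Int_ge:
  assumes "finite A" "finite B" "A \<inter> B = {}"
    and "properly_colored (complete_bipartite_edges A B) (head_coloring n G)"
  shows "card A * card B \<le> card (complete_bipartite_edges A B \<inter> G) + (card A + card B)"
proof -
  let ?E = "complete_bipartite_edges A B"
  have fin: "finite ?E"
    using assms by (simp add: finite_complete_bipartite_edges)
  have mem: "head n f \<in> f" if "f \<in> ?E" for f
    using that by (intro head_mem) (auto simp: complete_bipartite_edges_def)
  have "inj_on (head n) (?E - G)"
  proof (rule inj_onI, rule ccontr)
    fix f g
    assume *: "f \<in> ?E - G" "g \<in> ?E - G" "head n f = head n g" "f \<noteq> g"
    then have "f \<inter> g \<noteq> {}"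
      using mem[of f] mem[of g] by auto
    then show False
      using * assms(4) unfolding properly_colored_def head_coloring_def by (metis DiffD1 DiffD2)
  qed
  moreover have "head n ` (?E - G) \<subseteq> A \<union> B"
  proof
    fix x assume "x \<in> head n ` (?E - G)"
    then obtain f where "f \<in> ?E" "x \<in> f"
      using mem by blast
    then show "x \<in> A \<union> B"
      by (auto simp: complete_bipartite_edges_def)
  qed
  ultimately have "card (?E - G) \<le> card (A \<union> B)"
    using assms by (intro card_inj_on_le) auto
  also have "\<dots> \<le> card A + card B"
    by (rule card_Un_le)
  finally have "card ?E \<le> card (?E \<inter> G) + (card A + card B)"
    using card_Int_Diff[OF fin, of G] by simp
  then show ?thesis
    using assms by (simp add: card_complete_bipartite_edges)
qed

text \<open>These offsets lead to out-neighbors: seen from \<open>v + a\<close>, the vertex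
  \<open>v\<close> has offset \<open>n - a\<close>, which is between 1 and
  \<open>(n - 1) div 2\<close>. The antipodal offset for even \<open>n\<close> is excluded.\<close>

lemma head_pair_far:
  assumes "v < n" "n div 2 < a" "a < n"
  shows "head n {v, (v + a) mod n} = (v + a) mod n"
  using assms mod_add_if[of v n a]
  by (auto simp: head_def max_def min_def)

lemma head_less:
  assumes "u < n" "v < n"
  shows "head n {u, v} < n"
  using head_mem[of "{u, v}" n] assms by auto

lemma color_degree_head_coloring_ge:
  assumes dk: "d * k \<le> (n - 1) div 2"
    and w: "w \<in> {..<n} \<times> {..<d} \<rightarrow> {..<k}" and v: "v < n"
    and G: "G = (\<lambda>x. arc n k (x, w x)) ` ({..<n} \<times> {..<d})"
  shows "(n - 1) div 2 + d \<le> color_degree (complete_graph_edges {..<n}) (head_coloring n G) v"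
proof -
  \<comment> \<open>\<open>D\<close> holds the offsets of the selected in-neighbors of
    \<open>v\<close>, and \<open>D'\<close> those of its out-neighbors except a possible antipodal
    one. The edges from \<open>v\<close> to all of these turn out to have distinct colors.\<close>
  define D where "D = (\<lambda>i. Suc (i * k + w (v, i))) ` {..<d}"
  define D' where "D' = {n div 2<..<n}"
  define nb where "nb = (\<lambda>a. (v + a) mod n)"
  have wk: "w (v, i) < k" if "i < d" for i
    using w v that by auto
  have D_le: "0 < a \<and> a \<le> (n - 1) div 2" if "a \<in> D" for a
    using that block_index_less[OF _ wk] dk by (fastforce simp: D_def)
  have range: "0 < a \<and> a < n" if "a \<in> D \<union> D'" for a
    using that D_le[of a] v by (fastforce simp: D'_def)
  have cardD: "card D = d"
    unfolding D_def
    by (subst card_image) (auto simp: inj_on_def dest!: block_index_inj(1)[OF _ wk wk])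
  have cardD': "card D' = (n - 1) div 2"
    using v by (simp add: D'_def)
  have disj: "D \<inter> D' = {}"
    using D_le by (fastforce simp: D'_def)
  have nb: "nb a < n" "nb a \<noteq> v" if "a \<in> D \<union> D'" for a
    using range[OF that] v mod_add_if[of v n a] by (auto simp: nb_def split: if_splits)
  have nb_inj: "a = b" if "nb a = nb b" "a \<in> D \<union> D'" "b \<in> D \<union> D'" for a b
    using range[OF that(2)] range[OF that(3)] that(1) v mod_add_if[of v n a] mod_add_if[of v n b]
    by (auto simp: nb_def split: if_splits)
  have in_G: "{v, nb a} \<in> G" if "a \<in> D" for a
  proof -
    obtain i where "i < d" "a = Suc (i * k + w (v, i))"
      using \<open>a \<in> D\<close> by (auto simp: D_def)
    then have "{v, nb a} = arc n k ((v, i), w (v, i))" "(v, i) \<in> {..<n} \<times> {..<d}"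
      using v by (simp_all add: arc_def nb_def)
    then show ?thesis
      unfolding G by blast
  qed
  have head_nb: "head n {v, nb a} = nb a" if "a \<in> D'" for a
    using that v unfolding nb_def D'_def by (intro head_pair_far) auto
  have less: "head n {v, nb a} < n" if "a \<in> D \<union> D'" for a
    using nb[OF that] v by (intro head_less)
  have "inj_on (\<lambda>a. head_coloring n G {v, nb a}) (D \<union> D')"
  proof (rule inj_onI)
    fix a b
    assume ab: "a \<in> D \<union> D'" "b \<in> D \<union> D'"
      and eq: "head_coloring n G {v, nb a} = head_coloring n G {v, nb b}"
    show "a = b"
    proof (cases "{v, nb a} \<in> G")
      case True
      \<comment> \<open>Colors on \<open>G\<close> are at least \<open>n\<close> and heads are below
        \<open>n\<close>, so equal colors mean that both edges or neither lie in
        \<open>G\<close>.\<close>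
      then have "{v, nb b} \<in> G"
        using eq less[OF ab(2)] by (auto simp: head_coloring_def split: if_splits)
      then have "{v, nb a} = {v, nb b}"
        using True eq set_encode_eq[of "{v, nb a}" "{v, nb b}"] by (simp add: head_coloring_def)
      then show ?thesis
        using ab nb nb_inj by (metis doubleton_eq_iff)
    next
      case False
      then have b: "{v, nb b} \<notin> G"
        using eq less[OF ab(1)] by (auto simp: head_coloring_def split: if_splits)
      \<comment> \<open>Edges with offset in \<open>D\<close> are in \<open>G\<close>. What remains
        are arcs leaving \<open>v\<close>, colored by their other endpoint.\<close>
      then have "a \<in> D'" "b \<in> D'"
        using ab False in_G by auto
      then show ?thesis
        using eq False b head_nb nb_inj[OF _ ab] by (simp add: head_coloring_def)
    qed
  qed
  then have "card ((\<lambda>a. head_coloring n G {v, nb a}) ` (D \<union> D')) = card (D \<union> D')"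
    by (rule card_image)
  also have "\<dots> = (n - 1) div 2 + d"
    using disj cardD cardD' by (subst card_Un_disjoint) (auto simp: D_def D'_def)
  finally have "(n - 1) div 2 + d = card ((\<lambda>a. head_coloring n G {v, nb a}) ` (D \<union> D'))"
    by simp
  also have "\<dots> \<le> color_degree (complete_graph_edges {..<n}) (head_coloring n G) v"
    unfolding color_degree_def
  proof (rule card_mono)
    have "finite (complete_graph_edges {..<n})"
      by (rule finite_subset[of _ "Pow {..<n}"]) (auto simp: complete_graph_edges_def)
    then show "finite (head_coloring n G ` {e \<in> complete_graph_edges {..<n}. v \<in> e})"
      by simp
    have "{v, nb a} \<in> complete_graph_edges {..<n}" if "a \<in> D \<union> D'" for a
      using nb[OF that] v by (auto simp: complete_graph_edges_def card_insert_if)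
    then show "(\<lambda>a. head_coloring n G {v, nb a}) ` (D \<union> D')
        \<subseteq> head_coloring n G ` {e \<in> complete_graph_edges {..<n}. v \<in> e}"
      by blast
  qed
  finally show ?thesis .
qed

section \<open>Combining the estimates and choosing the parameters\<close>

lemma exists_coloring:
  assumes "0 < s" "0 < t" "0 < k" "0 < n" and dk: "d * k \<le> (n - 1) div 2"
    and less: "n ^ (s + t) * 2 ^ (s * t) < k ^ (s * t - (s + t))"
  obtains c :: "nat set \<Rightarrow> nat"
  where "\<not> contains_properly_colored_biclique s t {..<n} (complete_graph_edges {..<n}) c"
    "(n - 1) div 2 + d \<le> min_color_degree {..<n} (complete_graph_edges {..<n}) c"
proof -
  obtain w where w: "w \<in> {..<n} \<times> {..<d} \<rightarrow> {..<k}"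
    "\<And>A B. A \<subseteq> {..<n} \<Longrightarrow> B \<subseteq> {..<n} \<Longrightarrow> A \<inter> B = {} \<Longrightarrow> card A = s \<Longrightarrow> card B = t \<Longrightarrow>
       card (complete_bipartite_edges A B \<inter> (\<lambda>x. arc n k (x, w x)) ` ({..<n} \<times> {..<d}))
         < s * t - (s + t)"
    using exists_sparse_selection[OF assms(1-3) dk less] by blast
  define G where "G = (\<lambda>x. arc n k (x, w x)) ` ({..<n} \<times> {..<d})"
  have "\<not> contains_properly_colored_biclique s t {..<n} (complete_graph_edges {..<n})
      (head_coloring n G)"
  proof
    assume "contains_properly_colored_biclique s t {..<n} (complete_graph_edges {..<n})
      (head_coloring n G)"
    then obtain A B where AB: "A \<subseteq> {..<n}" "B \<subseteq> {..<n}" "A \<inter> B = {}" "card A = s" "card B = t"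
      "properly_colored (complete_bipartite_edges A B) (head_coloring n G)"
      by (auto simp: contains_properly_colored_biclique_def)
    have "finite A" "finite B"
      using AB by (auto intro: finite_subset)
    then have "s * t \<le> card (complete_bipartite_edges A B \<inter> G) + (s + t)"
      using card_properly_colored_biclique_Int_ge AB by metis
    moreover have "card (complete_bipartite_edges A B \<inter> G) < s * t - (s + t)"
      unfolding G_def using AB by (intro w(2)) auto
    ultimately show False
      by simp
  qed
  moreover have "(n - 1) div 2 + d
      \<le> min_color_degree {..<n} (complete_graph_edges {..<n}) (head_coloring n G)"
    unfolding min_color_degree_def
    using color_degree_head_coloring_ge[OF dk w(1) _ G_def] \<open>0 < n\<close> by (subst Min_ge_iff) auto
  ultimately show thesis
    by (rule that)
qed

theorem theorem4p4:
  fixes s t :: nat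
  assumes "s > 0" and "t > 0" and "s * t > 2 * (s + t)"
  shows "\<exists>\<gamma>::real. \<gamma> > 0 \<and>
    (\<exists>N::nat. \<forall>n\<ge>N. \<exists>c :: nat set \<Rightarrow> nat.
       \<not> contains_properly_colored_biclique s t {..<n} (complete_graph_edges {..<n}) c \<and>
       real (min_color_degree {..<n} (complete_graph_edges {..<n}) c) >
         real n / 2 +
         \<gamma> * real n powr (1 - (real s + real t) / (real s * real t - real s - real t)))"
proof -
  define e where "e = s * t - (s + t)"
  define b where "b = (real s + real t) / real e"
  \<comment> \<open>The power absorbs the number of arc subsets per biclique; the extra factor 2
    makes the inequality required of \<open>k\<close> strict.\<close>
  define C :: real where "C = 2 * 2 ^ (s * t)"
  have e: "s + t < e" "real e = real s * real t - real s - real t"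
    using assms by (auto simp: e_def of_nat_diff)
  have b: "0 < b" "b < 1"
    using e(1) assms by (auto simp: b_def field_simps)
  have C: "1 \<le> C"
    using mult_mono[of "1::real" 2 1 "2 ^ (s * t)"] by (simp add: C_def)
  \<comment> \<open>Below, \<open>d + 1\<close> exceeds n^(1-b) / (6C). Half of this is kept as the
    gain; the other half is more than 2 and covers the rounding losses of at most 1 each in
    \<open>d\<close> and in \<open>(n - 1) div 2\<close>.\<close>
  have "eventually (\<lambda>n::nat. 2 < real n powr (1 - b) / (12 * C)) at_top"
    using b C by real_asymp
  then obtain N where N: "\<And>n. N \<le> n \<Longrightarrow> 2 < real n powr (1 - b) / (12 * C)"
    by (auto simp: eventually_at_top_linorder)
  have "\<exists>c :: nat set \<Rightarrow> nat.
       \<not> contains_properly_colored_biclique s t {..<n} (complete_graph_edges {..<n}) c \<and>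
       real n / 2 + 1 / (12 * C) * real n powr (1 - b)
         < real (min_color_degree {..<n} (complete_graph_edges {..<n}) c)"
    \<comment> \<open>The 6 ensures n/3 \<le> \<open>(n - 1) div 2\<close>.\<close>
    if n: "N + 6 \<le> n" for n
  proof -
    define k where "k = nat \<lceil>C * real n powr b\<rceil>"
    define d where "d = (n - 1) div 2 div k"
    have nb: "1 \<le> real n powr b"
      using n b by (intro ge_one_powr_ge_zero) auto
    have Cn: "1 \<le> C * real n powr b"
      using mult_mono[OF C nb] C by simp
    \<comment> \<open>Rounding up at most doubles a real number that is at least 1.\<close>
    have k: "C * real n powr b \<le> k" "k \<le> 2 * C * real n powr b"
      using Cn by (auto simp: k_def) linarith+
    then have k0: "0 < k"
      using Cn by linarith
    have "real (n ^ (s + t) * 2 ^ (s * t)) < C * real n ^ (s + t)"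
      using n by (simp add: C_def)
    also have "\<dots> \<le> C ^ e * real n ^ (s + t)"
      using C e(1) self_le_power[of C e] by (intro mult_right_mono) auto
    \<comment> \<open>The exponent was chosen so that \<open>b * e = s + t\<close>.\<close>
    also have "\<dots> = (C * real n powr b) ^ e"
      using n e(1) by (simp add: power_mult_distrib b_def powr_powr flip: powr_realpow of_nat_add)
    also have "\<dots> \<le> real k ^ e"
      using k C by (intro power_mono) auto
    finally have "n ^ (s + t) * 2 ^ (s * t) < k ^ (s * t - (s + t))"
      unfolding e_def by (metis of_nat_less_iff of_nat_power)
    moreover have "d * k \<le> (n - 1) div 2"
      by (simp add: d_def)
    ultimately obtain c :: "nat set \<Rightarrow> nat"
      where c: "\<not> contains_properly_colored_biclique s t {..<n} (complete_graph_edges {..<n}) c"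
        "(n - 1) div 2 + d \<le> min_color_degree {..<n} (complete_graph_edges {..<n}) c"
      using exists_coloring[OF assms(1,2) k0, of n d] n by auto
    have "real n powr (1 - b) / (6 * C) = real n / 3 / (2 * C * real n powr b)"
      using n by (simp add: powr_diff)
    also have "\<dots> \<le> real n / 3 / real k"
      using k k0 C nb by (intro divide_left_mono) auto
    also have "\<dots> \<le> real ((n - 1) div 2) / real k"
      using n by (intro divide_right_mono) linarith+
    also have "\<dots> < real d + 1"
    proof -
      have "(n - 1) div 2 < (d + 1) * k"
        using dividend_less_div_times[OF k0] by (simp add: d_def)
      then have "real ((n - 1) div 2) < (real d + 1) * real k"
        by (metis of_nat_less_iff of_nat_mult of_nat_add of_nat_1)
      then show ?thesis
        using k0 by (simp add: pos_divide_less_eq)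
    qed
    finally have "1 + 1 / (12 * C) * real n powr (1 - b) < real d"
      using N[of n] n by simp
    moreover have "real n / 2 - 1 \<le> real ((n - 1) div 2)"
      using n by linarith
    ultimately show ?thesis
      using c by (intro exI[of _ c]) linarith
  qed
  then show ?thesis
    using C unfolding b_def e(2)
    by (intro exI[of _ "1 / (12 * C)"] conjI exI[of _ "N + 6"]) auto
qed

end
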